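(* Let $\langle K,R\rangle$ be a Kripke frame. The axiom scheme $(\varphi\rightarrow\psi)\rightarrow[(\psi\rightarrow\theta)\rightarrow(\varphi\rightarrow\theta)]$ is satisfied in $\langle K,R\rangle$ (i.e. every instance, for all formulas $\varphi,\psi,\theta$, holds at every node of every Kripke model on this frame) if and only if for every $k\in K$ the restriction of $R$ to $R^+[k]$ is transitive, i.e. for all $x,y,z\in R^+[k]$, $xRy$ and $yRz$ imply $xRz$.
   Context: Formulas are built from a countably infinite set of atoms and the constant $\bot$ (falsity) using the binary connectives $\&$ and $\rightarrow$. A Kripke frame is a pair $\langle K,R\rangle$ with $R\subseteq K\times K$ an arbitrary binary relation; a Kripke model on it is $\langle K,R,\vDash\rangle$ with $\vDash\subseteq K\times\mathsf{Atoms}$ arbitrary, extended to formulas by: $k\nvDash\bot$; $k\vDash\varphi\&\psi$ iff $k\vDash\varphi$ and $k\vDash\psi$; $k\vDash\varphi\rightarrow\psi$ iff for every $k'$ with $kRk'$, if $k'\vDash\varphi$ then $k'\vDash\psi$. For $k\in K$, $R^n[k]=\{x\mid \exists y_1,\dots,y_{n-1}\,(kRy_1R\cdots Ry_{n-1}Rx)\}$ and $R^+[k]=\bigcup_{n\ge1}R^n[k]$. *)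

theory Defs
  imports Main
begin

datatype fm =
    Atom nat
  | Falsity
  | Conj fm fm (infixr "\<^bold>\<and>" 70)
  | Imp fm fm (infixr "\<^bold>\<rightarrow>" 65)

definition kripke_frame :: "'w set \<Rightarrow> ('w \<times> 'w) set \<Rightarrow> bool" where
  "kripke_frame K R \<longleftrightarrow> R \<subseteq> K \<times> K"

definition kripke_model :: "'w set \<Rightarrow> ('w \<times> 'w) set \<Rightarrow> ('w \<times> nat) set \<Rightarrow> bool" where
  "kripke_model K R V \<longleftrightarrow> kripke_frame K R \<and> V \<subseteq> K \<times> UNIV"

text \<open>In a model over carrier \<open>K\<close> the successors of a node lie in \<open>K\<close>,
  so \<open>K\<close> itself is not an argument.\<close>

primrec forces :: "('w \<times> 'w) set \<Rightarrow> ('w \<times> nat) set \<Rightarrow> 'w \<Rightarrow> fm \<Rightarrow> bool" where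
  "forces R V k (Atom p) \<longleftrightarrow> (k, p) \<in> V"
| "forces R V k Falsity \<longleftrightarrow> False"
| "forces R V k (\<phi> \<^bold>\<and> \<psi>) \<longleftrightarrow> forces R V k \<phi> \<and> forces R V k \<psi>"
| "forces R V k (\<phi> \<^bold>\<rightarrow> \<psi>) \<longleftrightarrow>
     (\<forall>k'. (k, k') \<in> R \<longrightarrow> forces R V k' \<phi> \<longrightarrow> forces R V k' \<psi>)"

definition frame_satisfies :: "'w set \<Rightarrow> ('w \<times> 'w) set \<Rightarrow> fm \<Rightarrow> bool" where
  "frame_satisfies K R \<phi> \<longleftrightarrow> (\<forall>V. kripke_model K R V \<longrightarrow> (\<forall>k\<in>K. forces R V k \<phi>))"

definition reach_plus :: "('w \<times> 'w) set \<Rightarrow> 'w \<Rightarrow> 'w set" where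
  "reach_plus R k = (\<Union>n\<in>{1..}. (R ^^ n) `` {k})"

end

theory Submission
  imports Defs
begin

text \<open>Evaluating the scheme at k involves chains k R a R b R c, whose nodes a, b, c all lie in
  R^+[k]. Transitivity there gives a R c, so \<phi> at c yields \<psi> by the implication true at a,
  then \<theta> by the one true at b. Conversely, a failure of transitivity x R y R z inside R^+[k]
  is detected by an atom true only at z: its negation holds at x but not at y.\<close>

lemma reach_plus_iff_trancl: "x \<in> reach_plus R k \<longleftrightarrow> (k, x) \<in> R\<^sup>+"
  by (auto simp: reach_plus_def trancl_power Suc_le_eq)

theorem theorem2:
  fixes K :: "'w set" and R :: "('w \<times> 'w) set"
  assumes "kripke_frame K R"
  shows "(\<forall>\<phi> \<psi> \<theta>. frame_satisfies K R
            ((\<phi> \<^bold>\<rightarrow> \<psi>) \<^bold>\<rightarrow> ((\<psi> \<^bold>\<rightarrow> \<theta>) \<^bold>\<rightarrow> (\<phi> \<^bold>\<rightarrow> \<theta>))))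
         \<longleftrightarrow> (\<forall>k\<in>K. \<forall>x\<in>reach_plus R k. \<forall>y\<in>reach_plus R k. \<forall>z\<in>reach_plus R k.
                (x, y) \<in> R \<longrightarrow> (y, z) \<in> R \<longrightarrow> (x, z) \<in> R)"
    (is "?sat \<longleftrightarrow> ?trans")
proof
  assume sat: ?sat
  show ?trans
  proof (intro ballI impI, rule ccontr)
    fix k x y z
    assume x: "x \<in> reach_plus R k" and xy: "(x, y) \<in> R" and yz: "(y, z) \<in> R"
      and not_xz: "(x, z) \<notin> R"
    \<comment> \<open>An implication at a node constrains only its successors, so refuting the
      scheme needs a predecessor of x; the last edge of a path from k to x supplies one, possibly k
      itself.\<close>
    from x obtain w where wx: "(w, x) \<in> R"
      by (auto simp: reach_plus_iff_trancl elim: tranclE)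
    have "w \<in> K" "z \<in> K"
      using assms wx yz by (auto simp: kripke_frame_def)
    \<comment> \<open>With \<open>p\<close> true at \<open>z\<close> only, the instance \<open>\<phi> = p\<close>, \<open>\<psi> = \<theta> = \<bottom>\<close> fails at \<open>w\<close>.\<close>
    define V where "V = {(z, 0 :: nat)}"
    have "kripke_model K R V"
      using assms \<open>z \<in> K\<close> by (simp add: kripke_model_def V_def)
    with sat \<open>w \<in> K\<close>
    have "forces R V w ((Atom 0 \<^bold>\<rightarrow> Falsity) \<^bold>\<rightarrow>
        ((Falsity \<^bold>\<rightarrow> Falsity) \<^bold>\<rightarrow> (Atom 0 \<^bold>\<rightarrow> Falsity)))"
      unfolding frame_satisfies_def by blast
    moreover have "forces R V x (Atom 0 \<^bold>\<rightarrow> Falsity)"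
      using not_xz by (auto simp: V_def)
    ultimately have "forces R V y (Atom 0 \<^bold>\<rightarrow> Falsity)"
      using wx xy by simp
    with yz show False
      by (auto simp: V_def)
  qed
next
  assume trans: ?trans
  show ?sat
    unfolding frame_satisfies_def forces.simps
  proof (intro allI ballI impI)
    fix \<phi> \<psi> \<theta> V k a b c
    assume "k \<in> K" and ka: "(k, a) \<in> R" and ab: "(a, b) \<in> R" and bc: "(b, c) \<in> R"
      and a: "\<forall>c. (a, c) \<in> R \<longrightarrow> forces R V c \<phi> \<longrightarrow> forces R V c \<psi>"
      and b: "\<forall>c. (b, c) \<in> R \<longrightarrow> forces R V c \<psi> \<longrightarrow> forces R V c \<theta>"
      and c: "forces R V c \<phi>"
    have "(k, a) \<in> R\<^sup>+" "(k, b) \<in> R\<^sup>+" "(k, c) \<in> R\<^sup>+"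
      using ka ab bc by (blast intro: trancl_into_trancl)+
    with trans \<open>k \<in> K\<close> ab bc have "(a, c) \<in> R"
      unfolding reach_plus_iff_trancl[symmetric] by blast
    with a b c bc show "forces R V c \<theta>"
      by blast
  qed
qed

end
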